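(* For all $m\in\mathbb{N}$ (that is, all integers $m\geq 1$) we have $$\sum_{r \in \mathbb{Z}}\left( \frac{12}{r}\right)s\left(m-\frac{r^{2}}{24}+\frac{1}{24} \right) = 4\sigma_{1}(m)-2\sum_{d \mid m}\left(\min(6d,m/d)-\min(3d,2m/d) \right).$$
   Context: For an integer $n\ge 0$, $\mathrm{spt}(n)$ is Andrews' smallest parts function, which counts the total number of smallest parts in the partitions of $n$ (with $\mathrm{spt}(0)=0$), $p(n)$ is the partition function (with $p(0)=1$), and $$s(n)=\mathrm{spt}(n)+\frac{1}{12}(24n-1)p(n).$$ In particular $s(0)=-1/12$; $s(n)=0$ for negative $n$. $\left(\frac{12}{\cdot}\right)$ is the Kronecker symbol (which vanishes unless $\gcd(r,6)=1$, in which case the argument of $s$ is an integer). $\sigma_1(m)=\sum_{d\mid m}d$, and sums over $d\mid m$ run over positive divisors. *)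

theory Defs
  imports "HOL-Analysis.Analysis" "HOL-Number_Theory.Number_Theory" "HOL-Library.Multiset"
begin

definition partitions :: "nat \<Rightarrow> nat multiset set" where
  "partitions n = {P. 0 \<notin># P \<and> sum_mset P = n}"

lemma finite_partitions: "finite (partitions n)"
proof -
  have "P \<in> mset ` {xs. set xs \<subseteq> {0..n} \<and> length xs \<le> n}" if "P \<in> partitions n" for P
  proof -
    obtain xs where xs: "mset xs = P"
      using ex_mset by blast
    have pos: "0 \<notin> set xs" and sum: "sum_list xs = n"
      using that xs unfolding partitions_def by (auto simp: sum_mset_sum_list)
    have len: "length ys \<le> sum_list ys" if "0 \<notin> set ys" for ys :: "nat list"
      using that by (induction ys) auto
    show ?thesis
      using xs len[OF pos] sum member_le_sum_list[of _ xs] by force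
  qed
  then show ?thesis
    using finite_lists_length_le[of "{0..n}" n] by (meson finite_atLeastAtMost finite_imageI finite_subset subsetI)
qed

definition num_partitions :: "nat \<Rightarrow> nat" where
  "num_partitions n = card (partitions n)"

text \<open>The empty partition contributes 0, since every count in the empty multiset is 0;
  so the value at 0 is 0.\<close>

definition spt :: "nat \<Rightarrow> nat" where
  "spt n = (\<Sum>P\<in>partitions n. count P (Min (set_mset P)))"

definition s :: "int \<Rightarrow> real" where
  "s n = (if n < 0 then 0
          else real (spt (nat n)) + 1 / 12 * (24 * real_of_int n - 1) * real (num_partitions (nat n)))"

definition kronecker_prime :: "int \<Rightarrow> int \<Rightarrow> int" where
  "kronecker_prime a p =
     (if p = 2 then (if even a then 0 else if a mod 8 \<in> {1, 7} then 1 else -1)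
      else Legendre a p)"

text \<open>The Kronecker symbol $(a/n)$, extended multiplicatively from primes; the first factor
  of the product is the value $(a/u)$ at the unit $u = \pm 1$ with $n = u |n|$.\<close>

definition kronecker :: "int \<Rightarrow> int \<Rightarrow> int" where
  "kronecker a n =
     (if n = 0 then (if \<bar>a\<bar> = 1 then 1 else 0)
      else (if n < 0 \<and> a < 0 then -1 else 1) *
           (\<Prod>p\<in>prime_factors n. kronecker_prime a p ^ multiplicity p n))"

definition sigma1 :: "nat \<Rightarrow> nat" where
  "sigma1 m = (\<Sum>d | d dvd m. d)"

end

theory Submission
  imports Defs
begin

text \<open>
  Write $(q)_n = \prod_{k=1}^n (1-q^k)$ and $\alpha_0 = 1$,
  $\alpha_r = (-1)^r q^{r(3r-1)/2}(1+q^r)$ for $r \ge 1$. An integer coprime to $6$ is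
  $\pm(6k+1)$ for a unique $k$ and a unique sign, the symbol there is $(-1)^k$, and
  $(r^2-1)/24 = k(3k+1)/2$. The left-hand side is therefore twice the coefficient of $q^m$ in
  $(\sum_r \alpha_r) \sum_n s(n) q^n$, and by the pentagonal number theorem $\sum_r \alpha_r$ is
  $(q)_\infty$. The logarithmic derivative of $1/(q)_\infty$ turns the terms $n\,p(n)$ of $s(n)$
  into $\sum_n \sigma_1(n) q^n$, the terms $p(n)$ contribute only to the constant coefficient,
  and sorting partitions by their smallest part turns
  $(q)_\infty \sum_n \mathrm{spt}(n) q^n$ into $\sum_{n\ge1} (q)_{n-1} q^n/(1-q^n)$.

  What carries the proof is Andrews' identity
  \[ \sum_{n\ge1} (q)_{n-1}\frac{q^n}{1-q^n}
     = \sum_{n\ge1} \frac{q^n}{(1-q^n)^2}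
       + \sum_{r\ge1} \alpha_r \frac{q^r}{(1-q^r)^2}, \]
  whose right-hand side has explicit coefficients. It rests on two telescoping sums for the kernel
  $J(n,r) = 1/((q)_{n-r}(q)_{n+r})$: the Bailey pair $\sum_r \alpha_r J(n,r) = 1/(q)_n$
  (lemma \<open>pent_bailey_pair\<close>), which replaces a factor $1/(q)_n$ by a sum over $r$, and
  the $q$-Gauss type evaluation of $\sum_n (q)_{n-1}^2 q^n J(n,r)$ (lemma \<open>gauss_sum\<close>),
  which then carries out the sum over $n$. The Bailey pair also yields the pentagonal number
  theorem.

  There are no infinite products: for a fixed $N$ all sums stop at $N$, all products are finite,
  and identities hold modulo $q^{N+1}$, expressed as divisibility of the difference by
  \<open>fps_X ^ Suc N\<close>. Taking $N = m$ suffices.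

  The coefficient of $q^m$ in the last sum of Andrews' identity is a signed sum of
  $h(r) = \max(0, 2m/r - 3r)$ over the divisors $r$ of $2m$ for which $r$ and $2m/r$ have
  opposite parity. Such an even $r$ is twice a divisor of $m$ but not a divisor of $m$, such an
  odd $r$ is a divisor of $m$ but not twice one, so the sum is
  $\sum_{d \mid m} h(2d) - \sum_{d \mid m} h(d)$ (lemma \<open>pent_terms_sum\<close>). With
  $\min(x,y) = y - \max(0,y-x)$ this is the stated divisor sum.
\<close>

unbundle no vec_syntax
unbundle fps_syntax

section \<open>Finite $q$-factorials and their reciprocals\<close>

definition qpoch :: "nat \<Rightarrow> real fps" where
  "qpoch n = (\<Prod>k=1..n. 1 - fps_X ^ k)"

definition geo_inv :: "nat \<Rightarrow> real fps" where
  "geo_inv k = inverse (1 - fps_X ^ k)"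

lemma qpoch_0 [simp]: "qpoch 0 = 1"
  by (simp add: qpoch_def)

lemma qpoch_Suc: "qpoch (Suc n) = qpoch n * (1 - fps_X ^ Suc n)"
  by (simp add: qpoch_def)

lemma qpoch_nth_0 [simp]: "qpoch n $ 0 = 1"
  by (induction n) (simp_all add: qpoch_Suc)

lemma qpoch_inverse [simp]: "qpoch n * inverse (qpoch n) = 1"
  by (rule inverse_mult_eq_1') simp

lemma mult_geo_inv:
  assumes "k \<ge> 1"
  shows "(1 - fps_X ^ k) * geo_inv k = 1"
  unfolding geo_inv_def using assms by (intro inverse_mult_eq_1') simp

lemma eq_mult_geo_invI:
  assumes "k \<ge> 1" "f * (1 - fps_X ^ k) = g"
  shows "f = g * geo_inv k"
proof -
  have "g * geo_inv k = f * ((1 - fps_X ^ k) * geo_inv k)"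
    using assms(2) by (simp add: mult.assoc)
  then show ?thesis
    using mult_geo_inv[OF assms(1)] by simp
qed

lemma inverse_qpoch_Suc: "inverse (qpoch (Suc n)) = inverse (qpoch n) * geo_inv (Suc n)"
  by (simp only: qpoch_Suc geo_inv_def fps_inverse_mult)

text \<open>Used from left to right, this expresses reciprocals of smaller $q$-factorials as polynomial
  multiples of those of larger ones. Identities between quotients of $q$-factorials thereby become
  polynomial identities times a common factor, and no division of power series is needed.\<close>

lemma inverse_qpoch_step: "inverse (qpoch n) = inverse (qpoch (Suc n)) * (1 - fps_X ^ Suc n)"
proof -
  have "inverse (qpoch (Suc n)) * (1 - fps_X ^ Suc n)
      = inverse (qpoch n) * ((1 - fps_X ^ Suc n) * geo_inv (Suc n))"
    unfolding inverse_qpoch_Suc by (simp only: ac_simps)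
  then show ?thesis
    by (simp only: mult_geo_inv[of "Suc n"] le_add1 plus_1_eq_Suc mult_1_right)
qed

section \<open>The pentagonal Bailey pair\<close>

text \<open>The kernel $J(n,r)$ of a Bailey pair relative to $1$. The value $0$ for $r > n$ is the usual
  convention $1/(q)_{-k} = 0$; it lets sums over $r$ be extended freely.\<close>

definition bailey_kernel :: "nat \<Rightarrow> nat \<Rightarrow> real fps" where
  "bailey_kernel n r = (if r \<le> n then inverse (qpoch (n - r)) * inverse (qpoch (n + r)) else 0)"

text \<open>At $r = n+1$ the left-hand side is $0$ by convention and the right-hand side by the factor
  $1 - q^0$, so the telescoping sums may run across the boundary.\<close>

lemma bailey_kernel_step:
  assumes "r \<le> Suc n"
  shows "bailey_kernel n r = bailey_kernel (Suc n) r * (1 - fps_X ^ (Suc n - r)) * (1 - fps_X ^ (Suc n + r))"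
proof (cases "r = Suc n")
  case True
  then show ?thesis by (simp add: bailey_kernel_def)
next
  case False
  with assms have "r \<le> n" by simp
  then show ?thesis
    using inverse_qpoch_step[of "n - r"] inverse_qpoch_step[of "n + r"]
    by (simp only: bailey_kernel_def Suc_diff_le le_SucI add_Suc if_True mult.commute mult.left_commute add_Suc_right)
qed

text \<open>Truncations of the sum of these series are truncations of Euler's pentagonal series: the
  exponents $r(3r-1)/2$ and $r(3r+1)/2$ belong to the indices $-r$ and $r$.\<close>

definition pent_term :: "nat \<Rightarrow> real fps" where
  "pent_term r = (if r = 0 then 1
             else (-1) ^ r * fps_X ^ (r * (3 * r - 1) div 2) * (1 + fps_X ^ r))"

text \<open>The antidifference $G(n+1,r)$ in a Wilf-Zeilberger pair for $F(n,r) = (q)_n \alpha_r J(n,r)$,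
  that is $F(n+1,r) - F(n,r) = G(n+1,r) - G(n+1,r-1)$. Such a first-order relation exists because
  $\alpha_r$ joins the terms of index $r$ and $-r$ of the bilateral sum; the exponent
  $3r(r+1)/2$ is forced by comparing coefficients of $q^n$.\<close>

definition pent_certificate :: "nat \<Rightarrow> nat \<Rightarrow> real fps" where
  "pent_certificate n r = (-1) ^ r * fps_X ^ (3 * (r * (r + 1) div 2) + Suc n) * qpoch n *
     (1 - fps_X ^ (Suc n - r)) * bailey_kernel (Suc n) r"

lemma pentagonal_Suc: "(Suc r) * (3 * Suc r - 1) div 2 = 3 * (r * (r + 1) div 2) + r + 1"
proof -
  have "even (r * (r + 1))" by simp
  then obtain t where t: "r * (r + 1) = 2 * t" by (elim evenE)
  have "(Suc r) * (3 * Suc r - 1) = 3 * (r * (r + 1)) + 2 * r + 2"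
    by (simp add: algebra_simps)
  then show ?thesis unfolding t by simp
qed

text \<open>Over the common factor $(q)_n J(n+1,r+1)$ both sides are polynomials in
  $q$, $q^r$ and $q^{n-r}$ times $q^{3r(r+1)/2}$.\<close>

lemma pent_telescope:
  assumes "Suc r \<le> Suc n"
  shows "qpoch (Suc n) * pent_term (Suc r) * bailey_kernel (Suc n) (Suc r) - qpoch n * pent_term (Suc r) * bailey_kernel n (Suc r)
       = pent_certificate n (Suc r) - pent_certificate n r"
proof -
  define t where "t = 3 * (r * (r + 1) div 2)"
  have e1: "(Suc r) * (3 * Suc r - 1) div 2 = t + r + 1"
    unfolding t_def by (rule pentagonal_Suc)
  have e2: "3 * (Suc r * (Suc r + 1) div 2) = t + 3 * r + 3"
  proof -
    have "Suc r * (Suc r + 1) = r * (r + 1) + 2 * Suc r" by simp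
    then have "Suc r * (Suc r + 1) div 2 = r * (r + 1) div 2 + Suc r"
      by (simp only: div_mult_self2)
    then show ?thesis unfolding t_def by simp
  qed
  obtain d where n: "n = d + r" using assms by (metis Suc_le_mono le_Suc_ex add.commute)
  define J where "J = bailey_kernel (Suc n) (Suc r)"
  have J: "bailey_kernel (Suc n) r * (1 - fps_X ^ (Suc n - r)) = J * (1 - fps_X ^ (Suc n + Suc r))"
  proof -
    have "inverse (qpoch (n - r)) = inverse (qpoch (Suc n - r)) * (1 - fps_X ^ (Suc n - r))"
      using inverse_qpoch_step[of "n - r"] assms by (simp add: Suc_diff_le)
    moreover have "inverse (qpoch (Suc n + r)) = inverse (qpoch (Suc n + Suc r)) * (1 - fps_X ^ (Suc n + Suc r))"
      using inverse_qpoch_step[of "Suc n + r"] by simp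
    ultimately show ?thesis
      using assms unfolding J_def bailey_kernel_def by (simp del: power_Suc)
  qed
  have K: "bailey_kernel n (Suc r) = J * (1 - fps_X ^ (Suc n - Suc r)) * (1 - fps_X ^ (Suc n + Suc r))"
    unfolding J_def by (rule bailey_kernel_step[OF assms])
  \<comment> \<open>with $n = d + r$, all powers of $q$ become monomials in $q$, $q^d$, $q^r$ and $q^t$\<close>
  define a b c e :: "real fps" where
    "a = fps_X ^ d" and "b = fps_X ^ r" and "c = fps_X ^ t" and "e = (-1) ^ r"
  define x :: "real fps" where "x = fps_X"
  have p: "pent_term (Suc r) = - e * (c * b * x) * (1 + b * x)"
    unfolding pent_term_def e1 by (simp add: a_def b_def c_def e_def x_def power_add mult_2)
  have c1: "pent_certificate n r = e * (c * a * b * x) * qpoch n * (J * (1 - a * b * b * x * x))"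
  proof -
    have "pent_certificate n r = e * (c * a * b * x) * qpoch n * (bailey_kernel (Suc n) r * (1 - fps_X ^ (Suc n - r)))"
      unfolding pent_certificate_def t_def[symmetric] by (simp add: n a_def b_def c_def e_def x_def power_add ac_simps)
    then show ?thesis
      unfolding J by (simp add: n a_def b_def c_def e_def x_def power_add ac_simps)
  qed
  have c2: "pent_certificate n (Suc r) = - e * (c * b * b * b * x * x * x * (a * b * x)) * qpoch n * (1 - a) * J"
    unfolding pent_certificate_def e2 J_def
    by (simp add: n a_def b_def c_def e_def x_def power_add numeral_3_eq_3 ac_simps)
  have k: "bailey_kernel n (Suc r) = J * (1 - a) * (1 - a * b * b * x * x)"
    unfolding K by (simp add: n a_def b_def x_def power_add ac_simps)
  have qq: "qpoch (Suc n) = qpoch n * (1 - a * b * x)"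
    unfolding qpoch_Suc by (simp add: n a_def b_def x_def power_add ac_simps)
  show ?thesis
    unfolding qq p c1 c2 k J_def[symmetric] by (simp add: algebra_simps power2_eq_square)
qed

text \<open>After multiplication by $(q)_n$ the sum does not depend on $n$: the telescoping terms vanish at
  the upper end, and at the lower end they cancel the change of the term $r = 0$.\<close>

lemma pent_bailey_pair: "(\<Sum>r\<le>n. pent_term r * bailey_kernel n r) = inverse (qpoch n)"
proof -
  have "qpoch n * (\<Sum>r\<le>n. pent_term r * bailey_kernel n r) = 1"
  proof (induction n)
    case 0
    show ?case by (simp add: pent_term_def bailey_kernel_def)
  next
    case (Suc n)
    let ?F = "\<lambda>n r. qpoch n * pent_term r * bailey_kernel n r"
    have ext: "(\<Sum>r\<le>n. ?F n r) = (\<Sum>r\<le>Suc n. ?F n r)"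
      by (simp add: bailey_kernel_def)
    have r0: "?F (Suc n) 0 - ?F n 0 = pent_certificate n 0"
    proof -
      have "pent_certificate n 0 = fps_X ^ Suc n * qpoch n * (inverse (qpoch (Suc n)) * (1 - fps_X ^ Suc n)) * inverse (qpoch (Suc n))"
        by (simp add: pent_certificate_def bailey_kernel_def ac_simps del: power_Suc qpoch_inverse inverse_mult_eq_1)
      also have "\<dots> = fps_X ^ Suc n * (qpoch n * inverse (qpoch n)) * inverse (qpoch (Suc n))"
        unfolding inverse_qpoch_step[of n, symmetric] by (simp only: mult.assoc)
      also have "\<dots> = fps_X ^ Suc n * inverse (qpoch (Suc n))" by simp
      finally have c: "pent_certificate n 0 = fps_X ^ Suc n * inverse (qpoch (Suc n))" .
      have "?F (Suc n) 0 = inverse (qpoch (Suc n))"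
        by (simp add: pent_term_def bailey_kernel_def mult.assoc[symmetric])
      moreover have "?F n 0 = inverse (qpoch (Suc n)) * (1 - fps_X ^ Suc n)"
        unfolding inverse_qpoch_step[of n, symmetric] by (simp add: pent_term_def bailey_kernel_def mult.assoc[symmetric])
      ultimately show ?thesis by (simp only: c) (simp add: algebra_simps)
    qed
    have "(\<Sum>r\<le>Suc n. ?F (Suc n) r) - (\<Sum>r\<le>n. ?F n r) = (\<Sum>r\<le>Suc n. ?F (Suc n) r - ?F n r)"
      unfolding ext sum_subtractf ..
    also have "\<dots> = pent_certificate n 0 + (\<Sum>r\<le>n. ?F (Suc n) (Suc r) - ?F n (Suc r))"
      by (simp only: sum.atMost_Suc_shift r0)
    also have "(\<Sum>r\<le>n. ?F (Suc n) (Suc r) - ?F n (Suc r)) = (\<Sum>r\<le>n. pent_certificate n (Suc r) - pent_certificate n r)"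
      by (intro sum.cong refl pent_telescope) simp
    also have "\<dots> = pent_certificate n (Suc n) - pent_certificate n 0"
      by (simp only: sum_lessThan_telescope flip: lessThan_Suc_atMost)
    also have "pent_certificate n (Suc n) = 0"
      by (simp add: pent_certificate_def)
    finally show ?case
      using Suc by (simp add: sum_distrib_left distrib_left mult.assoc)
  qed
  then show ?thesis
    by (metis (no_types, lifting) mult.assoc mult.commute mult_1_right qpoch_inverse)
qed

section \<open>Andrews' identity and the pentagonal number theorem\<close>

text \<open>This quotient $(q)_n^2/((q)_{n-r}(q)_{n+r})$ is at once the antidifference that sums the kernel
  over $n$ and a quantity close to $1$ for large $n$.\<close>

definition kernel_ratio :: "nat \<Rightarrow> nat \<Rightarrow> real fps" where
  "kernel_ratio n r = (qpoch n)\<^sup>2 * bailey_kernel n r"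

text \<open>A truncated form of the $q$-Gauss sum. It telescopes since
  $(1-q^n)^2 - (1-q^{n-r})(1-q^{n+r}) = q^{n-r}(1-q^r)^2$.\<close>

lemma gauss_sum:
  assumes "r \<ge> 1"
  shows "(\<Sum>n<N. (qpoch n)\<^sup>2 * fps_X ^ Suc n * bailey_kernel (Suc n) r) = fps_X ^ r * (geo_inv r)\<^sup>2 * kernel_ratio N r"
proof (induction N)
  case 0
  show ?case using assms by (simp add: kernel_ratio_def bailey_kernel_def)
next
  case (Suc N)
  have step: "(qpoch N)\<^sup>2 * fps_X ^ Suc N * bailey_kernel (Suc N) r
      = fps_X ^ r * (geo_inv r)\<^sup>2 * (kernel_ratio (Suc N) r - kernel_ratio N r)"
  proof (cases "r \<le> Suc N")
    case False
    then show ?thesis by (simp add: kernel_ratio_def bailey_kernel_def)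
  next
    case True
    then obtain d where d: "Suc N = d + r" by (metis le_Suc_ex add.commute)
    define a b w J Q :: "real fps" where "a = fps_X ^ d" and "b = fps_X ^ r" and "w = geo_inv r"
      and "J = bailey_kernel (Suc N) r" and "Q = qpoch N"
    have w: "w * (1 - b) = 1"
      using mult_geo_inv[OF assms] by (simp add: w_def b_def mult.commute)
    have k: "bailey_kernel N r = J * (1 - a) * (1 - a * b * b)"
      unfolding bailey_kernel_step[OF True] unfolding d by (simp add: J_def d a_def b_def power_add ac_simps)
    have q: "qpoch (Suc N) = Q * (1 - a * b)"
      unfolding qpoch_Suc unfolding d by (simp add: Q_def a_def b_def power_add)
    have x: "fps_X ^ Suc N = a * b"
      unfolding d by (simp add: a_def b_def power_add)
    have "b * w\<^sup>2 * ((Q * (1 - a * b))\<^sup>2 * J - Q\<^sup>2 * (J * (1 - a) * (1 - a * b * b)))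
        = Q\<^sup>2 * (a * b) * J * (w * (1 - b))\<^sup>2"
      by (simp add: algebra_simps power2_eq_square)
    then show ?thesis
      unfolding kernel_ratio_def k q x w J_def[symmetric] Q_def[symmetric] b_def[symmetric] w_def[symmetric]
      by (simp only: w power_one mult_1_right mult.assoc right_diff_distrib)
  qed
  show ?case
    unfolding sum.lessThan_Suc Suc step by (simp add: algebra_simps)
qed

lemma qpoch_cong:
  "fps_X ^ Suc n dvd qpoch (n + k) - qpoch n"
proof (induction k)
  case (Suc k)
  have "qpoch (n + Suc k) - qpoch n = (qpoch (n + k) - qpoch n) - fps_X ^ Suc n * (fps_X ^ k * qpoch (n + k))"
    by (simp add: qpoch_Suc algebra_simps power_add)
  then show ?case using Suc by (metis dvd_diff dvd_triv_left)
qed simp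

text \<open>All three $q$-factorials in the quotient agree with $(q)_{n-r}$ modulo $q^{n-r+1}$.\<close>

lemma kernel_ratio_cong:
  assumes "r \<le> n"
  shows "fps_X ^ Suc (n - r) dvd kernel_ratio n r - 1"
proof -
  define A B C where "A = qpoch (n - r)" and "B = qpoch n" and "C = qpoch (n + r)"
  \<comment> \<open>$B^2 - AC = B(B-A) - A(C-B)$, and both differences are small\<close>
  have "B - A = qpoch (n - r + r) - qpoch (n - r)" "C - B = qpoch (n + r) - qpoch n"
    using assms by (simp_all add: A_def B_def C_def)
  then have 1: "fps_X ^ Suc (n - r) dvd B - A" and 2: "fps_X ^ Suc n dvd C - B"
    using qpoch_cong by metis+
  from 2 have 2: "fps_X ^ Suc (n - r) dvd C - B"
    by (rule power_le_dvd) simp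
  have A: "A * inverse A = 1" and C: "C * inverse C = 1"
    by (simp_all add: A_def C_def)
  have "(B * (B - A) - A * (C - B)) * (inverse A * inverse C)
      = B\<^sup>2 * (inverse A * inverse C) - (A * inverse A) * (C * inverse C)"
    by (simp add: algebra_simps power2_eq_square)
  also have "\<dots> = kernel_ratio n r - 1"
    unfolding A C using assms by (simp add: kernel_ratio_def bailey_kernel_def A_def B_def C_def)
  finally have "kernel_ratio n r - 1 = (B * (B - A) - A * (C - B)) * (inverse A * inverse C)" ..
  then show ?thesis using 1 2 by (simp add: dvd_diff)
qed

text \<open>The order of $\alpha_r$ is at least $r$, which makes up exactly for the precision $n-r$ of the
  quotient.\<close>

lemma pent_kernel_ratio_cong:
  assumes "1 \<le> r" "r \<le> n"
  shows "fps_X ^ Suc n dvd pent_term r * (kernel_ratio n r - 1)"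
proof -
  have "r \<le> r * (3 * r - 1) div 2"
    using assms(1) pentagonal_Suc[of "r - 1"] by simp
  then have "fps_X ^ r dvd pent_term r"
    using assms by (simp add: pent_term_def le_imp_power_dvd dvd_mult dvd_mult2)
  then have "fps_X ^ r * fps_X ^ Suc (n - r) dvd pent_term r * (kernel_ratio n r - 1)"
    using kernel_ratio_cong[OF assms(2)] by (rule mult_dvd_mono)
  moreover have "fps_X ^ r * fps_X ^ Suc (n - r) = (fps_X ^ Suc n :: real fps)"
  proof -
    have "r + Suc (n - r) = Suc n" using assms by simp
    then show ?thesis by (metis power_add)
  qed
  ultimately show ?thesis by (simp only:)
qed

text \<open>Euler's pentagonal number theorem in truncated form: multiply the Bailey pair by $(q)_N^2$ and
  replace each quotient of $q$-factorials by $1$.\<close>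

lemma pentagonal_cong:
  "fps_X ^ Suc N dvd qpoch N - (\<Sum>r\<le>N. pent_term r)"
proof -
  have "qpoch N = (qpoch N)\<^sup>2 * inverse (qpoch N)"
    by (simp add: power2_eq_square mult.assoc)
  also have "\<dots> = (\<Sum>r\<le>N. pent_term r * kernel_ratio N r)"
    unfolding pent_bailey_pair[symmetric] sum_distrib_left kernel_ratio_def by (simp add: ac_simps)
  finally have "qpoch N - (\<Sum>r\<le>N. pent_term r) = (\<Sum>r\<le>N. pent_term r * (kernel_ratio N r - 1))"
    by (simp add: sum_subtractf algebra_simps)
  moreover have "fps_X ^ Suc N dvd pent_term r * (kernel_ratio N r - 1)" if "r \<le> N" for r
  proof (cases "r = 0")
    case True
    then show ?thesis using kernel_ratio_cong[of 0 N] by (simp add: pent_term_def)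
  qed (use that pent_kernel_ratio_cong in auto)
  ultimately show ?thesis by (auto intro!: dvd_sum)
qed

text \<open>In each summand $(q)_{n-1}/(1-q^n) = (q)_{n-1}^2/(q)_n$, and the Bailey pair expands $1/(q)_n$.
  The term $r = 0$ gives the first sum on the right; for $r \ge 1$ the sum over $n$ is evaluated
  by the $q$-Gauss sum, up to a factor that is $1$ to the required order.\<close>

lemma andrews_cong:
  "fps_X ^ Suc N dvd (\<Sum>n=1..N. qpoch (n - 1) * fps_X ^ n * geo_inv n)
     - ((\<Sum>n=1..N. fps_X ^ n * (geo_inv n)\<^sup>2) + (\<Sum>r=1..N. pent_term r * (fps_X ^ r * (geo_inv r)\<^sup>2)))"
proof -
  have summand: "qpoch n * fps_X ^ Suc n * geo_inv (Suc n)
      = fps_X ^ Suc n * (geo_inv (Suc n))\<^sup>2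
        + (\<Sum>r=1..N. pent_term r * ((qpoch n)\<^sup>2 * fps_X ^ Suc n * bailey_kernel (Suc n) r))"
    if "n < N" for n
  proof -
    have g: "qpoch n * inverse (qpoch (Suc n)) = geo_inv (Suc n)"
      unfolding inverse_qpoch_Suc by (simp flip: mult.assoc)
    have "qpoch n * fps_X ^ Suc n * geo_inv (Suc n)
        = (qpoch n)\<^sup>2 * fps_X ^ Suc n * inverse (qpoch (Suc n))"
      unfolding g[symmetric] power2_eq_square by (simp only: ac_simps)
    also have "inverse (qpoch (Suc n)) = (\<Sum>r\<le>Suc n. pent_term r * bailey_kernel (Suc n) r)"
      by (rule pent_bailey_pair[symmetric])
    also have "\<dots> = (\<Sum>r\<le>N. pent_term r * bailey_kernel (Suc n) r)"
      using that by (intro sum.mono_neutral_left) (auto simp: bailey_kernel_def)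
    also have "\<dots> = bailey_kernel (Suc n) 0 + (\<Sum>r=1..N. pent_term r * bailey_kernel (Suc n) r)"
      by (simp add: atMost_atLeast0 sum.atLeast_Suc_atMost pent_term_def)
    also have "(qpoch n)\<^sup>2 * fps_X ^ Suc n * \<dots>
      = fps_X ^ Suc n * (qpoch n * inverse (qpoch (Suc n)))\<^sup>2
        + (\<Sum>r=1..N. pent_term r * ((qpoch n)\<^sup>2 * fps_X ^ Suc n * bailey_kernel (Suc n) r))"
      by (simp add: bailey_kernel_def distrib_left sum_distrib_left power2_eq_square ac_simps)
    finally show ?thesis unfolding g .
  qed
  have shift: "(\<Sum>n=1..N. f n) = (\<Sum>n<N. f (Suc n))" for f :: "nat \<Rightarrow> real fps"
    by (rule sum.reindex_bij_witness[of _ Suc "\<lambda>n. n - 1"]) auto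
  have "(\<Sum>n=1..N. qpoch (n - 1) * fps_X ^ n * geo_inv n)
      = (\<Sum>n<N. fps_X ^ Suc n * (geo_inv (Suc n))\<^sup>2
          + (\<Sum>r=1..N. pent_term r * ((qpoch n)\<^sup>2 * fps_X ^ Suc n * bailey_kernel (Suc n) r)))"
    unfolding shift[of "\<lambda>n. qpoch (n - 1) * fps_X ^ n * geo_inv n"]
    using summand by (intro sum.cong) (simp_all del: power_Suc)
  also have "\<dots> = (\<Sum>n=1..N. fps_X ^ n * (geo_inv n)\<^sup>2)
      + (\<Sum>n<N. \<Sum>r=1..N. pent_term r * ((qpoch n)\<^sup>2 * fps_X ^ Suc n * bailey_kernel (Suc n) r))"
    unfolding shift[of "\<lambda>n. fps_X ^ n * (geo_inv n)\<^sup>2"] sum.distrib ..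
  also have "(\<Sum>n<N. \<Sum>r=1..N. pent_term r * ((qpoch n)\<^sup>2 * fps_X ^ Suc n * bailey_kernel (Suc n) r))
      = (\<Sum>r=1..N. pent_term r * (fps_X ^ r * (geo_inv r)\<^sup>2 * kernel_ratio N r))"
    by (subst sum.swap) (simp add: gauss_sum flip: sum_distrib_left del: power_Suc)
  finally have "(\<Sum>n=1..N. qpoch (n - 1) * fps_X ^ n * geo_inv n)
       - ((\<Sum>n=1..N. fps_X ^ n * (geo_inv n)\<^sup>2) + (\<Sum>r=1..N. pent_term r * (fps_X ^ r * (geo_inv r)\<^sup>2)))
     = (\<Sum>r=1..N. pent_term r * (kernel_ratio N r - 1) * (fps_X ^ r * (geo_inv r)\<^sup>2))"
    by (simp add: algebra_simps sum_subtractf)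
  then show ?thesis
    by (simp only:) (intro dvd_sum dvd_mult2 pent_kernel_ratio_cong, auto)
qed

section \<open>Partitions and smallest parts\<close>

definition parts_in :: "nat set \<Rightarrow> nat \<Rightarrow> nat multiset set" where
  "parts_in A n = {P \<in> partitions n. set_mset P \<subseteq> A}"

lemma finite_parts_in [simp]: "finite (parts_in A n)"
  unfolding parts_in_def using finite_partitions by simp

text \<open>Removing one copy of $k$ is the bijection behind both generating functions below.\<close>

lemma parts_in_member:
  assumes "k \<ge> 1"
  shows "{P \<in> parts_in (insert k A) n. k \<in># P} =
         (if n < k then {} else add_mset k ` parts_in (insert k A) (n - k))"
proof (cases "n < k")
  case True
  have "k \<le> n" if "P \<in> partitions n" "k \<in># P" for P
    using that multi_member_split[of k P] by (auto simp: partitions_def)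
  then show ?thesis using True by (auto simp: parts_in_def)
next
  case False
  have "P \<in> add_mset k ` parts_in (insert k A) (n - k)"
    if P: "P \<in> parts_in (insert k A) n" "k \<in># P" for P
  proof -
    obtain Q where "P = add_mset k Q" using P(2) by (meson multi_member_split)
    then show ?thesis
      using P by (auto simp: parts_in_def partitions_def)
  qed
  moreover have "add_mset k Q \<in> parts_in (insert k A) n" if "Q \<in> parts_in (insert k A) (n - k)" for Q
    using that False assms by (auto simp: parts_in_def partitions_def)
  ultimately show ?thesis using False by auto
qed

definition parts_gf :: "nat set \<Rightarrow> real fps" where
  "parts_gf A = Abs_fps (\<lambda>n. real (card (parts_in A n)))"

text \<open>For $A = \{k..N\}$, weighting each partition by the multiplicity of $k$ counts
  occurrences of $k$ as a smallest part, because a partition without $k$ has weight $0$.\<close>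

definition mult_gf :: "nat \<Rightarrow> nat set \<Rightarrow> real fps" where
  "mult_gf k A = Abs_fps (\<lambda>n. \<Sum>P\<in>parts_in A n. real (count P k))"

lemma parts_gf_empty: "parts_gf {} = 1"
proof -
  have "parts_in {} n = (if n = 0 then {{#}} else {})" for n
    by (auto simp: parts_in_def partitions_def)
  then show ?thesis by (intro fps_ext) (simp add: parts_gf_def)
qed

lemma parts_gf_insert:
  assumes "k \<ge> 1" "k \<notin> A"
  shows "parts_gf (insert k A) * (1 - fps_X ^ k) = parts_gf A"
proof (rule fps_ext)
  fix n
  have split: "parts_in (insert k A) n = parts_in A n \<union> {P \<in> parts_in (insert k A) n. k \<in># P}"
    using assms by (auto simp: parts_in_def)
  have "card (parts_in (insert k A) n)
      = card (parts_in A n) + card {P \<in> parts_in (insert k A) n. k \<in># P}"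
    by (subst split, subst card_Un_disjoint) (use assms in \<open>auto simp: parts_in_def[of A] finite_partitions\<close>)
  then show "(parts_gf (insert k A) * (1 - fps_X ^ k)) $ n = parts_gf A $ n"
    unfolding parts_in_member[OF assms(1)]
    by (simp add: parts_gf_def right_diff_distrib fps_X_power_mult_right_nth card_image inj_on_def)
qed

text \<open>Adding a copy of $k$ raises the multiplicity by one, which gives
  $M = q^k (P + M)$ for the weighted series $M$ and the unweighted series $P$.\<close>

lemma mult_gf_eq:
  assumes "k \<ge> 1"
  shows "mult_gf k (insert k A) = fps_X ^ k * parts_gf (insert k A) * geo_inv k"
proof (rule eq_mult_geo_invI[OF assms], rule fps_ext)
  fix n
  have "(\<Sum>P\<in>parts_in (insert k A) n. real (count P k))
      = (\<Sum>P\<in>{P \<in> parts_in (insert k A) n. k \<in># P}. real (count P k))"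
    by (intro sum.mono_neutral_right) (auto simp: not_in_iff)
  also have "\<dots> = (if n < k then 0 else \<Sum>P\<in>parts_in (insert k A) (n - k). 1 + real (count P k))"
    unfolding parts_in_member[OF assms] by (auto simp: sum.reindex inj_on_def)
  finally show "(mult_gf k (insert k A) * (1 - fps_X ^ k)) $ n = (fps_X ^ k * parts_gf (insert k A)) $ n"
    by (simp add: mult_gf_def parts_gf_def right_diff_distrib fps_X_power_mult_right_nth
        fps_X_power_mult_nth sum.distrib)
qed

text \<open>Adjoining the part sizes one at a time, from $N$ downwards, cancels one factor of $(q)_N$ each.\<close>

lemma qpoch_mult_parts_gf:
  assumes "j \<le> N"
  shows "qpoch N * parts_gf {Suc j..N} = qpoch j"
  using assms
proof (induction rule: inc_induct)
  case base
  show ?case by (simp add: parts_gf_empty)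
next
  case (step j)
  have "insert (Suc j) {Suc (Suc j)..N} = {Suc j..N}"
    using step.hyps by auto
  then have "parts_gf {Suc j..N} * (1 - fps_X ^ Suc j) = parts_gf {Suc (Suc j)..N}"
    using parts_gf_insert[of "Suc j" "{Suc (Suc j)..N}"] by simp
  then have "(qpoch N * parts_gf {Suc j..N}) * (1 - fps_X ^ Suc j) = qpoch j * (1 - fps_X ^ Suc j)"
    using step.IH by (simp only: mult.assoc qpoch_Suc)
  moreover have "1 - fps_X ^ Suc j \<noteq> (0 :: real fps)"
    using mult_geo_inv[of "Suc j"] by (metis le_add1 mult_zero_left plus_1_eq_Suc zero_neq_one)
  ultimately show ?case by simp
qed

lemma partitions_eq_parts_in:
  assumes "n \<le> N"
  shows "partitions n = parts_in {1..N} n"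
proof -
  have "x \<le> n" if "P \<in> partitions n" "x \<in># P" for P x
    using that multi_member_split[of x P] by (auto simp: partitions_def)
  moreover have "x \<ge> 1" if "P \<in> partitions n" "x \<in># P" for P x
    using that by (cases x) (auto simp: partitions_def)
  ultimately show ?thesis
    using assms unfolding parts_in_def by fastforce
qed

lemma num_partitions_gf:
  assumes "n \<le> N"
  shows "real (num_partitions n) = inverse (qpoch N) $ n"
proof -
  have "qpoch N * parts_gf {1..N} = 1"
    using qpoch_mult_parts_gf[of 0 N] by simp
  then have "parts_gf {1..N} = inverse (qpoch N)"
    by (metis fps_inverse_unique)
  moreover have "real (num_partitions n) = parts_gf {1..N} $ n"
    unfolding num_partitions_def partitions_eq_parts_in[OF assms] by (simp add: parts_gf_def)
  ultimately show ?thesis by simp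
qed

text \<open>For a partition $P$ only $k = \min P$ contributes: for smaller $k$ the multiplicity vanishes, for
  larger $k$ the parts of $P$ do not all lie in $\{k..N\}$.\<close>

lemma spt_gf:
  assumes "n \<le> N"
  shows "real (spt n) = (\<Sum>k=1..N. mult_gf k {k..N}) $ n"
proof -
  have "real (count P (Min (set_mset P)))
      = (\<Sum>k=1..N. if set_mset P \<subseteq> {k..N} then real (count P k) else 0)"
    if P: "P \<in> partitions n" for P
  proof (cases "P = {#}")
    case False
    define a where "a = Min (set_mset P)"
    have a: "a \<in># P" using False by (simp add: a_def)
    have sub: "set_mset P \<subseteq> {1..N}"
      using P unfolding partitions_eq_parts_in[OF assms] by (simp add: parts_in_def)
    have "set_mset P \<subseteq> {a..N}"
      using sub by (auto simp: a_def)
    moreover have "\<not> set_mset P \<subseteq> {k..N} \<or> k \<notin># P" if "k \<noteq> a" for k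
      using that a unfolding a_def by (metis Min_eqI atLeastAtMost_iff finite_set_mset subset_iff)
    ultimately have "(if set_mset P \<subseteq> {k..N} then real (count P k) else 0)
        = (if k = a then real (count P a) else 0)" for k
      by (metis not_in_iff of_nat_0)
    then show ?thesis
      using a sub by (auto simp: a_def[symmetric])
  qed simp
  then have "real (spt n)
      = (\<Sum>P\<in>partitions n. \<Sum>k=1..N. if set_mset P \<subseteq> {k..N} then real (count P k) else 0)"
    by (simp add: spt_def)
  also have "\<dots> = (\<Sum>k=1..N. \<Sum>P\<in>partitions n. if set_mset P \<subseteq> {k..N} then real (count P k) else 0)"
    by (rule sum.swap)
  also have "\<dots> = (\<Sum>k=1..N. mult_gf k {k..N} $ n)"
    by (intro sum.cong refl) (simp add: mult_gf_def parts_in_def finite_partitions sum.If_cases Int_def)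
  finally show ?thesis by (simp add: fps_sum_nth)
qed

lemma qpoch_mult_spt_gf:
  "qpoch N * (\<Sum>k=1..N. mult_gf k {k..N}) = (\<Sum>k=1..N. qpoch (k - 1) * fps_X ^ k * geo_inv k)"
proof -
  have "qpoch N * mult_gf k {k..N} = qpoch (k - 1) * fps_X ^ k * geo_inv k" if "k \<in> {1..N}" for k
  proof -
    have "insert k {Suc k..N} = {k..N}" using that by auto
    then have "mult_gf k {k..N} = fps_X ^ k * parts_gf {k..N} * geo_inv k"
      using mult_gf_eq[of k "{Suc k..N}"] that by simp
    moreover have "qpoch N * parts_gf {k..N} = qpoch (k - 1)"
      using qpoch_mult_parts_gf[of "k - 1" N] that by (cases k) auto
    ultimately show ?thesis by (metis mult.assoc mult.commute)
  qed
  then show ?thesis by (simp add: sum_distrib_left)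
qed

text \<open>Induction form of $(q)_N \cdot q\frac{d}{dq}\frac1{(q)_N} = \sum_{k \le N} k q^k/(1-q^k)$.
  The right-hand side generates $\sigma_1$ up to $q^N$.\<close>

lemma log_deriv_qpoch:
  "qpoch N * (fps_X * fps_deriv (inverse (qpoch N))) = (\<Sum>k=1..N. of_nat k * (fps_X ^ k * geo_inv k))"
proof (induction N)
  case (Suc N)
  define Q I x w D :: "real fps" where "Q = qpoch N" and "I = inverse Q" and "x = fps_X ^ Suc N"
    and "w = geo_inv (Suc N)" and "D = fps_deriv I"
  have QI: "Q * I = 1" by (simp add: Q_def I_def)
  have w: "(1 - x) * w = 1" unfolding x_def w_def by (rule mult_geo_inv) simp
  have "fps_deriv (1 - x) = - (of_nat (Suc N) * fps_X ^ N)"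
    by (simp add: x_def fps_deriv_power fps_of_nat del: power_Suc of_nat_Suc)
  then have dw: "fps_X * fps_deriv w = of_nat (Suc N) * x * w\<^sup>2"
    unfolding w_def geo_inv_def x_def
    by (subst fps_inverse_deriv) (simp_all add: ac_simps)
  have "qpoch (Suc N) * (fps_X * fps_deriv (inverse (qpoch (Suc N))))
      = Q * (1 - x) * (fps_X * D * w + I * (fps_X * fps_deriv w))"
    unfolding inverse_qpoch_Suc unfolding qpoch_Suc
    by (simp only: Q_def I_def x_def w_def D_def fps_deriv_mult distrib_left ac_simps)
  also have "\<dots> = ((1 - x) * w) * (Q * (fps_X * D)) + (Q * I) * ((1 - x) * w) * (of_nat (Suc N) * x * w)"
    unfolding dw by (simp add: algebra_simps power2_eq_square)
  also have "\<dots> = Q * (fps_X * D) + of_nat (Suc N) * (x * w)"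
    unfolding w QI by (simp only: mult_1_left mult.assoc)
  finally show ?case
    using Suc unfolding Q_def D_def I_def x_def w_def by simp
qed simp

section \<open>Coefficients of the rational terms\<close>

lemma geo_inv_nth:
  assumes "k \<ge> 1"
  shows "geo_inv k $ n = (if k dvd n then 1 else 0)"
proof -
  have "Abs_fps (\<lambda>n. if k dvd n then 1 else 0) = 1 * geo_inv k"
  proof (rule eq_mult_geo_invI[OF assms], rule fps_ext)
    fix n
    show "(Abs_fps (\<lambda>n. if k dvd n then 1 else 0) * (1 - fps_X ^ k)) $ n = (1 :: real fps) $ n"
    proof (cases "n < k")
      case True
      then have "k dvd n \<longleftrightarrow> n = 0" by (auto dest: dvd_imp_le)
      then show ?thesis using True
        by (simp add: right_diff_distrib fps_X_power_mult_right_nth)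
    next
      case False
      then have "k dvd n - k \<longleftrightarrow> k dvd n" by (simp add: dvd_minus_self)
      then show ?thesis using False assms
        by (simp add: right_diff_distrib fps_X_power_mult_right_nth)
    qed
  qed
  then have "geo_inv k = Abs_fps (\<lambda>n. if k dvd n then 1 else 0)" by simp
  then show ?thesis by simp
qed

lemma X_geo_inv_nth:
  assumes "k \<ge> 1"
  shows "(fps_X ^ k * geo_inv k) $ n = (if k dvd n \<and> n \<noteq> 0 then 1 else 0)"
proof -
  have "fps_X ^ k * geo_inv k = geo_inv k - 1"
    using mult_geo_inv[OF assms] by (simp add: algebra_simps)
  then show ?thesis by (simp add: geo_inv_nth[OF assms])
qed

lemma X_geo_inv_square_nth:
  assumes "k \<ge> 1"
  shows "(fps_X ^ k * (geo_inv k)\<^sup>2) $ n = (if k dvd n then real (n div k) else 0)"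
proof -
  have "Abs_fps (\<lambda>n. if k dvd n then real (n div k) else 0) = (fps_X ^ k * geo_inv k) * geo_inv k"
  proof (rule eq_mult_geo_invI[OF assms], rule fps_ext)
    fix n
    show "(Abs_fps (\<lambda>n. if k dvd n then real (n div k) else 0) * (1 - fps_X ^ k)) $ n
        = (fps_X ^ k * geo_inv k) $ n"
    proof (cases "n < k")
      case True
      then have "k dvd n \<longleftrightarrow> n = 0" by (auto dest: dvd_imp_le)
      then show ?thesis using True
        by (cases "n = 0") (simp_all add: right_diff_distrib fps_X_power_mult_right_nth X_geo_inv_nth[OF assms])
    next
      case False
      then have "n div k = Suc ((n - k) div k)" using assms by (simp add: div_if)
      moreover have "k dvd n - k \<longleftrightarrow> k dvd n" using False by (simp add: dvd_minus_self)
      ultimately show ?thesis using False assms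
        by (simp add: right_diff_distrib fps_X_power_mult_right_nth X_geo_inv_nth[OF assms])
    qed
  qed
  then have "fps_X ^ k * (geo_inv k)\<^sup>2 = Abs_fps (\<lambda>n. if k dvd n then real (n div k) else 0)"
    by (simp only: power2_eq_square mult.assoc)
  then show ?thesis by simp
qed

lemma sigma1_eq:
  assumes "m \<ge> 1"
  shows "sigma1 m = (\<Sum>d | d dvd m. m div d)"
proof -
  have "m div (m div d) = d \<and> m div d dvd m" if "d dvd m" for d
  proof -
    obtain k where k: "m = d * k" using \<open>d dvd m\<close> by (elim dvdE)
    then have "d > 0" "k > 0" using assms by (cases d; cases k; simp)+
    then have "m div d = k" "m div k = d" unfolding k by simp_all
    then show ?thesis unfolding k by simp
  qed
  then show ?thesis
    unfolding sigma1_def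
    by (intro sum.reindex_bij_witness[of _ "\<lambda>d. m div d" "\<lambda>d. m div d"]) simp_all
qed

lemma sum_divisors_eq:
  fixes m :: nat
  assumes "m \<ge> 1"
  shows "(\<Sum>k=1..m. if k dvd m then f k else 0) = (\<Sum>d | d dvd m. f d :: real)"
proof (intro sum.mono_neutral_cong_right)
  show "{d. d dvd m} \<subseteq> {1..m}"
    using assms dvd_imp_le[of _ m] dvd_pos_nat[of m] by (auto simp: Suc_le_eq)
qed auto

text \<open>From $(1+x)x/(1-x)^2 = \sum_{k\ge1} (2k-1)x^k$ with $x = q^r$: the exponent
  $m = r(3r-1)/2 + rk$ means $2m/r - 3r = 2k-1$. For integers $r \mid 2m$ this difference is odd
  exactly under the parity condition, and the maximum with $0$ cuts off the indices $k \le 0$.\<close>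

lemma pent_term_geo_nth:
  assumes "r \<ge> 1"
  shows "(pent_term r * (fps_X ^ r * (geo_inv r)\<^sup>2)) $ m =
    (if r dvd 2 * m \<and> odd (2 * m div r + r)
     then (-1) ^ r * max 0 (2 * real m / real r - 3 * real r) else 0)"
proof -
  define a where "a = r * (3 * r - 1) div 2"
  have "even (r * (3 * r - 1))" using assms by (cases "even r") auto
  then have a: "2 * a = r * (3 * r - 1)" unfolding a_def by (rule dvd_mult_div_cancel)
  define c where "c n = (if r dvd n then real (n div r) else 0)" for n
  have sgn: "(-1) ^ r = fps_const ((-1) ^ r :: real)"
    by (simp add: fps_const_power[symmetric] fps_const_neg[symmetric] del: fps_const_neg fps_const_power)
  have *: "pent_term r * (fps_X ^ r * (geo_inv r)\<^sup>2) = fps_const ((-1) ^ r) *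
      (fps_X ^ a * (fps_X ^ r * (geo_inv r)\<^sup>2) + fps_X ^ (a + r) * (fps_X ^ r * (geo_inv r)\<^sup>2))"
    using assms by (simp add: pent_term_def sgn a_def algebra_simps power_add)
  have coeff: "(pent_term r * (fps_X ^ r * (geo_inv r)\<^sup>2)) $ m
      = (-1) ^ r * ((if m < a then 0 else c (m - a)) + (if m < a + r then 0 else c (m - (a + r))))"
  proof -
    define G where "G = fps_X ^ r * (geo_inv r)\<^sup>2"
    have "G $ n = c n" for n
      unfolding G_def c_def by (rule X_geo_inv_square_nth[OF assms])
    then show ?thesis
      unfolding * unfolding G_def[symmetric]
      by (simp only: fps_mult_left_const_nth fps_add_nth fps_X_power_mult_nth)
  qed
  show ?thesis
  proof (cases "\<exists>k. m = a + r * k")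
    case True
    then obtain k where k: "m = a + r * k" ..
    have 2: "2 * m = r * (3 * r - 1 + 2 * k)"
      unfolding k distrib_left a by simp
    then have q: "2 * m div r = 3 * r - 1 + 2 * k"
      using assms by simp
    have "2 * real m = real r * (3 * real r - 1 + 2 * real k)"
      using arg_cong[OF 2, of real] assms by (simp add: of_nat_diff)
    then have h: "2 * real m / real r - 3 * real r = 2 * real k - 1"
      using assms by (simp add: field_simps)
    have odd: "odd (2 * m div r + r)" unfolding q using assms by simp
    show ?thesis
    proof (cases k)
      case 0
      then show ?thesis unfolding coeff h using k assms by (simp add: c_def)
    next
      case (Suc l)
      have "m - (a + r) = r * l" "m - a = r * Suc l" "\<not> m < a + r" "\<not> m < a" 
        by (simp_all add: k Suc)
      then show ?thesis unfolding coeff h using 2 odd assms Suc by (simp add: c_def)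
    qed
  next
    case False
    have 0: "c (m - a) = 0" if "m \<ge> a"
      using False that by (auto simp: c_def dvd_def) (metis le_add_diff_inverse)
    have 1: "c (m - (a + r)) = 0" if "m \<ge> a + r"
    proof (rule ccontr)
      assume "c (m - (a + r)) \<noteq> 0"
      then obtain l where "m - (a + r) = r * l" by (auto simp: c_def dvd_def split: if_splits)
      then have "m = a + r * Suc l" using that by simp
      then show False using False by blast
    qed
    have "max 0 (2 * real m / real r - 3 * real r) = 0" if t: "r dvd 2 * m" "odd (2 * m div r + r)"
    proof (rule ccontr)
      assume *: "max 0 (2 * real m / real r - 3 * real r) \<noteq> 0"
      \<comment> \<open>a positive value would make $t - 3r$ odd and positive, hence $m = a + rk$ with $k \ge 1$\<close>
      obtain t where t': "2 * m = r * t" using t(1) by (elim dvdE)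
      then have "2 * m div r = t" using assms by simp
      with t have odd: "odd (t + r)" by simp
      have "2 * real m = real r * real t" using arg_cong[OF t', of real] by simp
      then have "2 * real m / real r = real t" using assms by simp
      with * have "real t > real (3 * r)" by (auto simp: max_def split: if_splits)
      then have "t > 3 * r" by linarith
      moreover have "odd (t - 3 * r)" using odd \<open>t > 3 * r\<close> by auto
      ultimately obtain l where "t - 3 * r = 2 * l + 1" by (meson oddE)
      then have "t = 3 * r - 1 + 2 * (l + 1)" using \<open>t > 3 * r\<close> assms by presburger
      then have "2 * m = 2 * (a + r * (l + 1))"
        unfolding t' distrib_left a by (simp add: distrib_left)
      then have "m = a + r * (l + 1)" by (rule mult_left_cancel[THEN iffD1, rotated]) simp
      then show False using False by blast
    qed
    then show ?thesis unfolding coeff using 0 1 by auto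
  qed
qed

text \<open>The parity condition selects the symmetric difference of the divisors of $m$ and their doubles,
  with sign $-1$ on the former and $+1$ on the latter. Divisors of $2m$ beyond $m$ are harmless
  because the maximum is $0$ there.\<close>

lemma pent_terms_sum:
  assumes "m \<ge> 1"
  shows "(\<Sum>r=1..m. (pent_term r * (fps_X ^ r * (geo_inv r)\<^sup>2)) $ m) =
    (\<Sum>d | d dvd m. max 0 (real m / real d - 6 * real d))
    - (\<Sum>d | d dvd m. max 0 (2 * real m / real d - 3 * real d))"
proof -
  define h where "h r = max 0 (2 * real m / real r - 3 * real r)" for r :: nat
  define C where "C r \<longleftrightarrow> r dvd 2 * m \<and> odd (2 * m div r + r)" for r
  let ?D = "{d. d dvd m}" and ?E = "{r. even r \<and> r dvd 2 * m}"
  have ind: "(if C r then (-1) ^ r * h r else 0) = (if r \<in> ?E then h r else 0) - (if r \<in> ?D then h r else 0)"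
    if r: "r \<ge> 1" for r
  proof (cases "r dvd 2 * m")
    case False
    then show ?thesis by (auto simp: C_def)
  next
    case True
    then obtain t where t: "2 * m = r * t" ..
    then have q: "2 * m div r = t" using r by simp
    have "r dvd m \<longleftrightarrow> even t"
    proof
      assume "r dvd m"
      then obtain k where k: "m = r * k" ..
      have "r * t = r * (2 * k)" using t unfolding k by (metis mult.left_commute)
      then have "t = 2 * k" using r by (metis mult_left_cancel not_one_le_zero)
      then show "even t" by simp
    next
      assume "even t"
      then obtain k where "t = 2 * k" ..
      then have "m = r * k" using t by simp
      then show "r dvd m" by simp
    qed
    moreover have "even r \<or> even t" using t by (metis dvd_triv_left even_mult_iff)
    ultimately show ?thesis using True by (auto simp: C_def q)
  qed
  have "(\<Sum>r=1..m. (pent_term r * (fps_X ^ r * (geo_inv r)\<^sup>2)) $ m)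
      = (\<Sum>r=1..m. if C r then (-1) ^ r * h r else 0)"
    by (intro sum.cong refl, subst pent_term_geo_nth) (auto simp: C_def h_def)
  also have "\<dots> = (\<Sum>r=1..2*m. if C r then (-1) ^ r * h r else 0)"
  proof (intro sum.mono_neutral_left ballI)
    fix r assume "r \<in> {1..2 * m} - {1..m}"
    then have r: "r > m" by auto
    then have "2 * real m / real r \<le> 2" by (simp add: field_simps)
    also have "2 \<le> 3 * real r" using r assms by simp
    finally show "(if C r then (-1) ^ r * h r else 0) = 0" by (simp add: h_def)
  qed auto
  also have "\<dots> = (\<Sum>r=1..2*m. (if r \<in> ?E then h r else 0) - (if r \<in> ?D then h r else 0))"
    using ind by (intro sum.cong refl) auto
  also have "\<dots> = sum h ({1..2*m} \<inter> ?E) - sum h ({1..2*m} \<inter> ?D)"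
    by (simp only: sum_subtractf sum.inter_restrict finite_atLeastAtMost)
  also have "{1..2*m} \<inter> ?E = (\<lambda>d. 2 * d) ` ?D"
  proof -
    have "r \<in> {1..2*m}" if "r dvd 2 * m" for r
      using that assms dvd_imp_le[of r "2 * m"] dvd_pos_nat[of "2 * m" r] by simp
    then have "{1..2*m} \<inter> ?E = ?E" by blast
    also have "?E = (\<lambda>d. 2 * d) ` ?D"
    proof
      show "?E \<subseteq> (\<lambda>d. 2 * d) ` ?D"
      proof
        fix r assume "r \<in> ?E"
        then have "even r" "r dvd 2 * m" by simp_all
        moreover then obtain d where "r = 2 * d" by (elim evenE)
        ultimately show "r \<in> (\<lambda>d. 2 * d) ` ?D" by simp
      qed
    qed auto
    finally show ?thesis .
  qed
  also have "{1..2*m} \<inter> ?D = ?D"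
  proof -
    have "d \<in> {1..2*m}" if "d dvd m" for d
      using that assms dvd_imp_le[of d m] dvd_pos_nat[of m d] by simp
    then show ?thesis by blast
  qed
  also have "sum h ((\<lambda>d. 2 * d) ` ?D) = (\<Sum>d\<in>?D. h (2 * d))"
    by (subst sum.reindex) (auto simp: inj_on_def)
  also have "\<dots> = (\<Sum>d\<in>?D. max 0 (real m / real d - 6 * real d))"
    by (simp add: h_def)
  finally show ?thesis by (simp add: h_def)
qed

lemma cong_imp_nth_eq:
  assumes "fps_X ^ Suc N dvd f - (g :: real fps)" "n \<le> N"
  shows "f $ n = g $ n"
proof -
  obtain h where "f - g = fps_X ^ Suc N * h" using assms(1) ..
  then have "(f - g) $ n = (fps_X ^ Suc N * h) $ n" by (simp only:)
  then show ?thesis using assms(2) by (simp add: fps_X_power_mult_nth del: power_Suc)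
qed

lemma smallest_parts_coeff:
  assumes "m \<ge> 1"
  shows "(\<Sum>n=1..m. qpoch (n - 1) * fps_X ^ n * geo_inv n) $ m =
    real (sigma1 m) + (\<Sum>d | d dvd m. max 0 (real m / real d - 6 * real d))
    - (\<Sum>d | d dvd m. max 0 (2 * real m / real d - 3 * real d))"
proof -
  have "(\<Sum>n=1..m. qpoch (n - 1) * fps_X ^ n * geo_inv n) $ m
      = (\<Sum>n=1..m. (fps_X ^ n * (geo_inv n)\<^sup>2) $ m) + (\<Sum>r=1..m. (pent_term r * (fps_X ^ r * (geo_inv r)\<^sup>2)) $ m)"
    using cong_imp_nth_eq[OF andrews_cong[of m] order_refl] by (simp only: fps_add_nth fps_sum_nth)
  also have "(\<Sum>n=1..m. (fps_X ^ n * (geo_inv n)\<^sup>2) $ m) = (\<Sum>n=1..m. if n dvd m then real (m div n) else 0)"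
    by (intro sum.cong refl X_geo_inv_square_nth) auto
  also have "\<dots> = real (sigma1 m)"
    unfolding sum_divisors_eq[OF assms] sigma1_eq[OF assms] by simp
  finally show ?thesis unfolding pent_terms_sum[OF assms] by simp
qed

text \<open>The series of $s$ is $S + 2 q P' - P/12$ with $S$ and $P$ the series of $\mathrm{spt}$ and $p$.
  Up to $q^m$ these are given by partitions into parts $\le m$, and the pentagonal series may be
  replaced by $(q)_m$.\<close>

lemma pent_s_coeff:
  assumes "m \<ge> 1"
  shows "((\<Sum>r\<le>m. pent_term r) * Abs_fps (\<lambda>n. s (int n))) $ m =
    2 * real (sigma1 m)
    - (\<Sum>d | d dvd m. min (6 * real d) (real m / real d) - min (3 * real d) (2 * real m / real d))"
proof -
  define P where "P = inverse (qpoch m)"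
  define T where "T = (\<Sum>k=1..m. mult_gf k {k..m}) + fps_const 2 * (fps_X * fps_deriv P) - fps_const (1 / 12) * P"
  have s_eq: "s (int n) = T $ n" if "n \<le> m" for n
  proof -
    have "(fps_X * fps_deriv P) $ n = real n * P $ n"
      by (cases n) simp_all
    then show ?thesis
      using spt_gf[OF that] num_partitions_gf[OF that]
      by (simp add: s_def T_def P_def algebra_simps)
  qed
  have "((\<Sum>r\<le>m. pent_term r) * Abs_fps (\<lambda>n. s (int n))) $ m = ((\<Sum>r\<le>m. pent_term r) * T) $ m"
    unfolding fps_mult_nth by (intro sum.cong refl) (simp only: fps_nth_Abs_fps s_eq diff_le_self)
  also have "\<dots> = (qpoch m * T) $ m"
  proof (rule cong_imp_nth_eq[OF _ order_refl, symmetric])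
    show "fps_X ^ Suc m dvd qpoch m * T - (\<Sum>r\<le>m. pent_term r) * T"
      unfolding left_diff_distrib[symmetric] by (intro dvd_mult2 pentagonal_cong)
  qed
  also have "qpoch m * T = (\<Sum>k=1..m. qpoch (k - 1) * fps_X ^ k * geo_inv k)
      + fps_const 2 * (\<Sum>k=1..m. of_nat k * (fps_X ^ k * geo_inv k)) - fps_const (1 / 12)"
  proof -
    have "qpoch m * T = qpoch m * (\<Sum>k=1..m. mult_gf k {k..m})
        + fps_const 2 * (qpoch m * (fps_X * fps_deriv P)) - fps_const (1 / 12) * (qpoch m * P)"
      unfolding T_def by (simp only: distrib_left right_diff_distrib ac_simps)
    then show ?thesis
      unfolding P_def qpoch_mult_spt_gf log_deriv_qpoch by simp
  qed
  also have "\<dots> $ m = (\<Sum>k=1..m. qpoch (k - 1) * fps_X ^ k * geo_inv k) $ m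
      + 2 * (\<Sum>k=1..m. real k * (fps_X ^ k * geo_inv k) $ m)"
    using assms by (simp add: fps_sum_nth fps_of_nat[symmetric] fps_mult_left_const_nth)
  also have "(\<Sum>k=1..m. real k * (fps_X ^ k * geo_inv k) $ m) = (\<Sum>k=1..m. if k dvd m then real k else 0)"
    using assms by (intro sum.cong refl, subst X_geo_inv_nth) auto
  also have "\<dots> = real (sigma1 m)"
    unfolding sum_divisors_eq[OF assms] sigma1_def by simp
  also have "(\<Sum>k=1..m. qpoch (k - 1) * fps_X ^ k * geo_inv k) $ m
     = - (\<Sum>d | d dvd m. min (6 * real d) (real m / real d) - min (3 * real d) (2 * real m / real d))"
  proof -
    have mm: "min x y = y - max 0 (y - x)" for x y :: real by (simp add: min_def max_def)
    have "real (sigma1 m) = (\<Sum>d | d dvd m. real m / real d)"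
      unfolding sigma1_eq[OF assms] by (simp add: real_of_nat_div)
    moreover have "(\<Sum>d | d dvd m. min (6 * real d) (real m / real d) - min (3 * real d) (2 * real m / real d))
      = (\<Sum>d | d dvd m. max 0 (2 * real m / real d - 3 * real d)
          - max 0 (real m / real d - 6 * real d) - real m / real d)"
      by (intro sum.cong refl) (simp add: mm)
    ultimately show ?thesis
      unfolding smallest_parts_coeff[OF assms] by (simp add: sum_subtractf)
  qed
  finally show ?thesis by simp
qed

section \<open>The Kronecker symbol of 12\<close>

text \<open>The quadratic character of conductor $12$, in a form that is visibly periodic.\<close>

definition chi12 :: "int \<Rightarrow> int" where
  "chi12 n = (if n mod 12 \<in> {1, 11} then 1 else if n mod 12 \<in> {5, 7} then -1 else 0)"

lemma mod_12_cases:
  "(n :: int) mod 12 \<in> {0, 1, 2, 3, 4, 5, 6, 7, 8, 9, 10, 11}"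
proof -
  have "0 \<le> n mod 12" "n mod 12 < 12" by simp_all
  then show ?thesis by (simp only: insert_iff empty_iff) presburger
qed

lemma chi12_mult: "chi12 (a * b) = chi12 a * chi12 b"
proof -
  have "(a * b) mod 12 = ((a mod 12) * (b mod 12)) mod 12"
    by (simp add: mod_mult_eq)
  then show ?thesis
    using mod_12_cases[of a] mod_12_cases[of b] unfolding chi12_def
    by (elim insertE emptyE) simp_all
qed

lemma chi12_1 [simp]: "chi12 1 = 1"
  by (simp add: chi12_def)

lemma chi12_power: "chi12 (a ^ n) = chi12 a ^ n"
  by (induction n) (simp_all add: chi12_mult)

lemma chi12_prod: "chi12 (\<Prod>x\<in>A. f x) = (\<Prod>x\<in>A. chi12 (f x))"
  by (induction A rule: infinite_finite_induct) (simp_all add: chi12_mult)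

lemma chi12_abs: "chi12 \<bar>n\<bar> = chi12 n"
proof -
  have "chi12 (- n) = chi12 n"
    using mod_12_cases[of n] unfolding chi12_def zmod_zminus1_eq_if
    by (elim insertE emptyE) simp_all
  then show ?thesis by (simp add: abs_if)
qed

text \<open>The factor $4$ is a square, and $2$ is invertible modulo an odd number.\<close>

lemma QuadRes_12_iff:
  assumes "coprime p (2 :: int)"
  shows "QuadRes p 12 \<longleftrightarrow> QuadRes p 3"
proof
  assume "QuadRes p 3"
  then obtain y where "[y\<^sup>2 = 3] (mod p)" by (auto simp: QuadRes_def)
  then have "[2\<^sup>2 * y\<^sup>2 = 2\<^sup>2 * 3] (mod p)" by (rule cong_scalar_left)
  then have "[(2 * y)\<^sup>2 = 12] (mod p)" by (simp add: power_mult_distrib)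
  then show "QuadRes p 12" unfolding QuadRes_def by blast
next
  assume "QuadRes p 12"
  then obtain y where y: "[y\<^sup>2 = 12] (mod p)" by (auto simp: QuadRes_def)
  \<comment> \<open>half of the root $y$ modulo $p$ is a root of $3$\<close>
  obtain z where z: "[2 * z = y] (mod p)"
    using cong_solve_coprime_int[of 2 p] assms
    by (metis cong_scalar_right coprime_commute mult.assoc mult_1)
  have "[(2 * z)\<^sup>2 = 12] (mod p)" using cong_pow[OF z] y by (rule cong_trans)
  then have "[4 * z\<^sup>2 = 4 * 3] (mod p)" by (simp add: power_mult_distrib)
  moreover have "coprime 4 p"
  proof -
    have "coprime p (2 ^ 2)" using assms by (simp only: coprime_power_right_iff simp_thms)
    moreover have "(2 :: int) ^ 2 = 4" by simp
    ultimately show ?thesis by (metis coprime_commute)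
  qed
  ultimately have "[z\<^sup>2 = 3] (mod p)" using cong_mult_lcancel by blast
  then show "QuadRes p 3" by (auto simp: QuadRes_def)
qed

lemma Legendre_3:
  assumes "\<not> 3 dvd (p :: int)"
  shows "Legendre p 3 = (if p mod 3 = 1 then 1 else -1)"
proof -
  have p: "p mod 3 = 1 \<or> p mod 3 = 2" using assms by presburger
  have "y\<^sup>2 mod 3 \<noteq> 2" for y :: int
  proof -
    have "y mod 3 = 0 \<or> y mod 3 = 1 \<or> y mod 3 = 2" by presburger
    then show ?thesis by (subst power_mod[symmetric]) auto
  qed
  then have "QuadRes 3 p \<longleftrightarrow> p mod 3 = 1"
    using p by (auto simp: QuadRes_def cong_def intro: exI[of _ 1])
  then show ?thesis using assms by (auto simp: Legendre_def cong_def dvd_eq_mod_eq_0)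
qed

text \<open>Quadratic reciprocity for $3$ and $p$: the residue of $p$ modulo $3$ determines the reciprocal
  symbol, the residue modulo $4$ the sign.\<close>

lemma Legendre_12:
  fixes p :: int
  assumes "prime p" "p > 3"
  shows "Legendre 12 p = chi12 p"
proof -
  have odd: "odd p" using assms prime_odd_int by force
  have n3: "\<not> 3 dvd p"
    using assms primes_dvd_imp_eq[of 3 p] by auto
  have n12: "\<not> [12 = 0] (mod p)" and n30: "\<not> [3 = 0] (mod p)"
  proof -
    show n30: "\<not> [3 = 0] (mod p)" using assms zdvd_imp_le[of p 3] by (auto simp: cong_0_iff)
    have "\<not> p dvd 2" using assms zdvd_imp_le[of p 2] by auto
    then have "\<not> p dvd 2 * 2 * 3"
      using n30 assms(1) unfolding prime_dvd_mult_iff[OF assms(1)] cong_0_iff by simp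
    then show "\<not> [12 = 0] (mod p)" by (simp add: cong_0_iff)
  qed
  have "coprime p 2" using odd by simp
  then have l: "Legendre 12 p = Legendre 3 p"
    using n12 n30 QuadRes_12_iff by (simp add: Legendre_def)
  have "Legendre p 3 * Legendre 3 p = (-1) ^ nat ((p - 1) div 2 * ((3 - 1) div 2))"
  proof (rule Quadratic_Reciprocity_int)
    show "prime (nat p)" using assms(1) prime_int_nat_transfer by blast
  qed (use assms(2) in simp_all)
  then have e: "Legendre p 3 * Legendre 3 p = (if even ((p - 1) div 2) then 1 else -1)"
    using assms by (auto simp: even_nat_iff)
  have e2: "Legendre p 3 * Legendre p 3 = 1"
    using Legendre_3[OF n3] by simp
  have "Legendre 3 p = Legendre p 3 * (Legendre p 3 * Legendre 3 p)"
    by (simp add: e2 flip: mult.assoc)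
  then have "Legendre 3 p = Legendre p 3 * (if even ((p - 1) div 2) then 1 else -1)"
    unfolding e .
  then have "Legendre 3 p = (if p mod 3 = 1 then 1 else -1) * (if even ((p - 1) div 2) then 1 else -1)"
    unfolding Legendre_3[OF n3] .
  also have "\<dots> = chi12 p"
  proof -
    have "p mod 12 \<in> {1, 5, 7, 11}"
      using mod_12_cases[of p] odd n3 by (simp only: insert_iff empty_iff) presburger
    then consider k where "p = 12 * k + 1" | k where "p = 12 * k + 5" | k where "p = 12 * k + 7"
      | k where "p = 12 * k + 11"
      by (metis insertE empty_iff mult_div_mod_eq)
    then show ?thesis
    proof cases
      case (1 k)
      have "p mod 3 = 1" "even ((p - 1) div 2)" "p mod 12 = 1" using 1 by presburger+
      then show ?thesis by (simp add: chi12_def)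
    next
      case (2 k)
      have "p mod 3 = 2" "even ((p - 1) div 2)" "p mod 12 = 5" using 2 by presburger+
      then show ?thesis by (simp add: chi12_def)
    next
      case (3 k)
      have "p mod 3 = 1" "odd ((p - 1) div 2)" "p mod 12 = 7" using 3 by presburger+
      then show ?thesis by (simp add: chi12_def)
    next
      case (4 k)
      have "p mod 3 = 2" "odd ((p - 1) div 2)" "p mod 12 = 11" using 4 by presburger+
      then show ?thesis by (simp add: chi12_def)
    qed
  qed
  finally show ?thesis using l by simp
qed

lemma kronecker_prime_12:
  assumes "prime (p :: int)"
  shows "kronecker_prime 12 p = chi12 p"
proof -
  have "p \<ge> 2" using assms by (rule prime_ge_2_int)
  then consider "p = 2" | "p = 3" | "p > 3" by linarith
  then show ?thesis
  proof cases
    case 3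
    then show ?thesis using Legendre_12[OF assms] by (simp add: kronecker_prime_def)
  qed (auto simp: kronecker_prime_def chi12_def Legendre_def cong_def)
qed

text \<open>Both sides are completely multiplicative and agree at primes; since $12 > 0$ the unit
  contributes no sign.\<close>

lemma kronecker_12: "kronecker 12 n = chi12 n"
proof (cases "n = 0")
  case False
  have "kronecker 12 n = (\<Prod>p\<in>prime_factors n. chi12 (p ^ multiplicity p n))"
    using False by (auto simp: kronecker_def kronecker_prime_12 chi12_power in_prime_factors_iff intro!: prod.cong)
  also have "\<dots> = chi12 \<bar>n\<bar>"
    using False prod_prime_factors[of n] by (simp flip: chi12_prod)
  finally show ?thesis by (simp add: chi12_abs)
qed (simp add: kronecker_def chi12_def)

section \<open>The sum over integers coprime to six\<close>

lemma chi12_eq_0: "chi12 r = 0" if "r mod 6 \<noteq> 1" "r mod 6 \<noteq> 5"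
proof -
  have "r mod 12 mod 6 = r mod 6" by (simp add: mod_mod_cancel)
  with that show ?thesis by (auto simp: chi12_def)
qed

lemma chi12_6k_plus_1: "chi12 (6 * k + 1) = (if even k then 1 else -1)"
proof (cases "even k")
  case True
  then have "(6 * k + 1) mod 12 = 1" by presburger
  then show ?thesis using True by (simp add: chi12_def)
next
  case False
  then have "(6 * k + 1) mod 12 = 7" by presburger
  then show ?thesis using False by (simp add: chi12_def)
qed

lemma chi12_minus: "chi12 (- r) = chi12 r"
  by (metis abs_minus_cancel chi12_abs)

text \<open>The generalised pentagonal numbers, in the sign convention that makes them equal to
  $((6k+1)^2-1)/24$.\<close>

definition gen_pentagonal :: "int \<Rightarrow> int" where
  "gen_pentagonal k = k * (3 * k + 1) div 2"

lemma gen_pentagonal_double: "2 * gen_pentagonal k = k * (3 * k + 1)"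
proof -
  have "even (k * (3 * k + 1))" by simp
  then show ?thesis unfolding gen_pentagonal_def by (rule dvd_mult_div_cancel)
qed

text \<open>Confines the nonzero terms to $|k| \le m$.\<close>

lemma gen_pentagonal_ge_abs: "gen_pentagonal k \<ge> \<bar>k\<bar>"
proof -
  have "\<bar>k\<bar> * 2 \<le> k * (3 * k + 1)"
  proof (cases "k \<ge> 1")
    case True
    then have "k * 2 \<le> k * (3 * k + 1)" by (intro mult_left_mono) auto
    then show ?thesis using True by simp
  next
    case False
    then have "0 \<le> (- k) * (- (3 * k + 3))" if "k \<noteq> 0"
      using that by (intro mult_nonneg_nonneg) auto
    then show ?thesis using False by (cases "k = 0") (auto simp: algebra_simps)
  qed
  then show ?thesis using gen_pentagonal_double[of k] by linarith
qed

lemma floor_at_6k_plus_1: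
  "\<lfloor>real m - (real_of_int (6 * k + 1))\<^sup>2 / 24 + 1 / 24\<rfloor> = int m - gen_pentagonal k"
proof -
  have "2 * real_of_int (gen_pentagonal k) = real_of_int k * (3 * real_of_int k + 1)"
    using arg_cong[OF gen_pentagonal_double[of k], of real_of_int] by simp
  then have "real m - (real_of_int (6 * k + 1))\<^sup>2 / 24 + 1 / 24 = real_of_int (int m - gen_pentagonal k)"
    by (simp add: power2_eq_square field_simps)
  then show ?thesis by (simp only: floor_of_int)
qed

lemma sum_int_symmetric:
  fixes f :: "int \<Rightarrow> real"
  shows "(\<Sum>k\<in>{- int N..int N}. f k) = f 0 + (\<Sum>j=1..N. f (int j) + f (- int j))"
proof (induction N)
  case (Suc N)
  have "{- int (Suc N)..int (Suc N)} = insert (int (Suc N)) (insert (- int (Suc N)) {- int N..int N})"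
    by auto
  then show ?case using Suc by simp
qed simp

lemma pent_mult_nth:
  assumes "j \<ge> 1"
  shows "(pent_term j * Abs_fps (\<lambda>n. s (int n))) $ m =
    (-1) ^ j * (s (int m - gen_pentagonal (int j)) + s (int m - gen_pentagonal (- int j)))"
proof -
  define a where "a = j * (3 * j - 1) div 2"
  have "even (j * (3 * j - 1))" using assms by (cases "even j") auto
  then have "2 * a = j * (3 * j - 1)" unfolding a_def by (rule dvd_mult_div_cancel)
  then have "2 * int a = int (j * (3 * j - 1))" by (metis of_nat_mult of_nat_numeral)
  also have "\<dots> = int j * (3 * int j - 1)" using assms by (simp add: of_nat_diff)
  finally have a: "2 * int a = int j * (3 * int j - 1)" .
  have g1: "gen_pentagonal (- int j) = int a"
    using gen_pentagonal_double[of "- int j"] a by (simp add: algebra_simps)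
  have g2: "gen_pentagonal (int j) = int (a + j)"
    using gen_pentagonal_double[of "int j"] a by (simp add: algebra_simps)
  have sgn: "(-1) ^ j = fps_const ((-1) ^ j :: real)"
    by (simp add: fps_const_power[symmetric] fps_const_neg[symmetric] del: fps_const_neg fps_const_power)
  define F where "F = Abs_fps (\<lambda>n. s (int n))"
  have shift: "(fps_X ^ b * F) $ m = s (int m - int b)" for b
  proof (cases "m < b")
    case True
    then show ?thesis by (simp add: F_def fps_X_power_mult_nth s_def)
  next
    case False
    then have "int m - int b = int (m - b)" by (simp add: of_nat_diff)
    then show ?thesis
      using False by (simp only: F_def fps_X_power_mult_nth fps_nth_Abs_fps if_False)
  qed
  have "pent_term j * F = fps_const ((-1) ^ j) * (fps_X ^ (a + j) * F + fps_X ^ a * F)"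
    using assms by (simp add: pent_term_def sgn a_def algebra_simps power_add)
  then show ?thesis
    unfolding F_def[symmetric] g1 g2
    by (simp only: fps_mult_left_const_nth fps_add_nth shift)
qed

theorem proposition1p6:
  fixes m :: nat
  assumes "m \<ge> 1"
  shows "((\<lambda>r::int. real_of_int (kronecker 12 r) *
                     s \<lfloor>real m - (real_of_int r)\<^sup>2 / 24 + 1 / 24\<rfloor>)
          has_sum
          (4 * real (sigma1 m)
            - 2 * (\<Sum>d | d dvd m. min (6 * real d) (real m / real d)
                                  - min (3 * real d) (2 * real m / real d)))) UNIV"
proof -
  define f where "f r = real_of_int (kronecker 12 r) * s \<lfloor>real m - (real_of_int r)\<^sup>2 / 24 + 1 / 24\<rfloor>"
    for r :: int
  define g where "g k = (if even k then 1 else -1) * s (int m - gen_pentagonal k)" for k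
  define K where "K = {- int m..int m}"
  define R where "R = (\<lambda>k. 6 * k + 1) ` K"
  have f_minus: "f (- r) = f r" for r
    by (simp add: f_def kronecker_12 chi12_minus)
  have f_g: "f (6 * k + 1) = g k" for k
    unfolding f_def g_def kronecker_12 chi12_6k_plus_1 floor_at_6k_plus_1 by simp
  have g_0: "g k = 0" if "k \<notin> K" for k
    using that gen_pentagonal_ge_abs[of k] by (auto simp: g_def K_def s_def)
  \<comment> \<open>the remaining integers share a factor with $6$ or make the argument of $s$ negative\<close>
  have outside: "f r = 0" if "r \<notin> R \<union> uminus ` R" for r
  proof -
    have "r mod 6 = 1 \<or> (- r) mod 6 = 1 \<or> r mod 6 \<noteq> 1 \<and> r mod 6 \<noteq> 5"
      by (cases "r mod 6 = 5") (simp_all add: zmod_zminus1_eq_if)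
    then consider "r mod 6 = 1" | "(- r) mod 6 = 1" | "r mod 6 \<noteq> 1" "r mod 6 \<noteq> 5"
      by blast
    then show ?thesis
    proof cases
      case 1
      then have r: "r = 6 * (r div 6) + 1" by presburger
      then have "r div 6 \<notin> K" using that by (auto simp: R_def)
      then show ?thesis using f_g[of "r div 6"] g_0 r by metis
    next
      case 2
      then obtain l where r: "r = - (6 * l + 1)"
        by (metis minus_minus mult_div_mod_eq)
      then have "l \<notin> K" using that unfolding R_def by blast
      then show ?thesis unfolding r f_minus f_g by (rule g_0)
    next
      case 3
      then show ?thesis by (simp add: f_def kronecker_12 chi12_eq_0)
    qed
  qed
  have fin: "finite R" by (simp add: R_def K_def)
  \<comment> \<open>the two signs give the residue classes $1$ and $5$ modulo $6$\<close>
  have disj: "R \<inter> uminus ` R = {}"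
  proof -
    have "6 * k + 1 \<noteq> - (6 * l + 1)" for k l :: int by presburger
    then show ?thesis by (auto simp: R_def)
  qed
  have "sum f (R \<union> uminus ` R) = sum f R + sum f (uminus ` R)"
    using fin disj by (intro sum.union_disjoint) auto
  also have "sum f (uminus ` R) = sum f R"
    by (subst sum.reindex) (auto simp: f_minus)
  also have "sum f R = (\<Sum>k\<in>K. g k)"
    unfolding R_def by (subst sum.reindex) (auto simp: f_g inj_on_def)
  also have "\<dots> = g 0 + (\<Sum>j=1..m. g (int j) + g (- int j))"
    unfolding K_def by (rule sum_int_symmetric)
  also have "\<dots> = ((\<Sum>r\<le>m. pent_term r) * Abs_fps (\<lambda>n. s (int n))) $ m"
  proof -
    have "((\<Sum>r\<le>m. pent_term r) * Abs_fps (\<lambda>n. s (int n))) $ m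
        = (\<Sum>r\<le>m. (pent_term r * Abs_fps (\<lambda>n. s (int n))) $ m)"
      by (simp add: sum_distrib_right fps_sum_nth)
    also have "\<dots> = (pent_term 0 * Abs_fps (\<lambda>n. s (int n))) $ m
        + (\<Sum>r=1..m. (pent_term r * Abs_fps (\<lambda>n. s (int n))) $ m)"
      by (simp add: atMost_atLeast0 sum.atLeast_Suc_atMost)
    also have "(pent_term 0 * Abs_fps (\<lambda>n. s (int n))) $ m = g 0"
      by (simp add: pent_term_def g_def gen_pentagonal_def)
    also have "(\<Sum>r=1..m. (pent_term r * Abs_fps (\<lambda>n. s (int n))) $ m)
        = (\<Sum>j=1..m. g (int j) + g (- int j))"
      by (intro sum.cong refl, subst pent_mult_nth) (auto simp: g_def distrib_left)
    finally show ?thesis by simp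
  qed
  finally have total: "sum f (R \<union> uminus ` R) = 4 * real (sigma1 m)
    - 2 * (\<Sum>d | d dvd m. min (6 * real d) (real m / real d) - min (3 * real d) (2 * real m / real d))"
    unfolding pent_s_coeff[OF assms] by simp
  have "(f has_sum sum f (R \<union> uminus ` R)) (R \<union> uminus ` R)"
    using fin by (intro has_sum_finite) auto
  then have "(f has_sum sum f (R \<union> uminus ` R)) UNIV"
    by (rule has_sum_cong_neutral[THEN iffD1, rotated -1]) (auto intro: outside)
  then show ?thesis unfolding total unfolding f_def .
qed

end
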